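(* For every $0<\alpha<1$ and $\beta\ge 0$, let $\Phi_{\alpha,\beta}(s)=\dfrac{s^\alpha}{\bigl(1+(1-\alpha)s^{\alpha-1}\bigr)^\beta}$ for $s>0$. Then $$\Phi_{\alpha,\beta}\in\mathcal{BF}\quad\Longleftrightarrow\quad 0\le\beta\le 1 .$$
   Context: $\mathcal{CM}$ is the class of completely monotone functions: $g\in C^\infty(0,\infty)$ with $(-1)^n g^{(n)}(s)\ge 0$ for all integers $n\ge 0$ and all $s>0$. $\mathcal{BF}$ is the class of Bernstein functions: $f\in C^\infty(0,\infty)$ with $f(s)\ge 0$ for all $s>0$ and $f'\in\mathcal{CM}$. *)

theory Defs
  imports "HOL-Analysis.Analysis"
begin

text \<open>
  The classes consist of functions on the open half-line; here they are total functions on the reals,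
  and all conditions involve only their values on the open set \<open>{0<..}\<close>, where derivatives are local.
\<close>

definition smooth_pos :: "(real \<Rightarrow> real) \<Rightarrow> bool" where
  "smooth_pos g \<longleftrightarrow> (\<forall>n. \<forall>s>0. (deriv ^^ n) g differentiable (at s))"

definition CM :: "(real \<Rightarrow> real) set" where
  "CM = {g. smooth_pos g \<and> (\<forall>n. \<forall>s>0. (-1) ^ n * (deriv ^^ n) g s \<ge> 0)}"

definition BF :: "(real \<Rightarrow> real) set" where
  "BF = {f. smooth_pos f \<and> (\<forall>s>0. f s \<ge> 0) \<and> deriv f \<in> CM}"

definition Phi :: "real \<Rightarrow> real \<Rightarrow> real \<Rightarrow> real" where
  "Phi \<alpha> \<beta> s = s powr \<alpha> / (1 + (1 - \<alpha>) * s powr (\<alpha> - 1)) powr \<beta>"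

end

theory Submission
  imports Defs
begin

text \<open>
  Put \<open>c = 1 - \<alpha>\<close> and \<open>G a p s = s\<^sup>-\<^sup>a (s\<^sup>c + c)\<^sup>-\<^sup>p\<close>. Then \<open>- G'\<close> is a combination of functions of
  the same form with coefficients \<open>a\<close> and \<open>p c\<close>, so the cone spanned by the \<open>G a p\<close> with \<open>a, p \<ge> 0\<close> is
  stable under \<open>g \<mapsto> - g'\<close> and consists of completely monotone functions.
  The derivative of \<open>\<Phi>\<close> is \<open>\<alpha> G a \<beta> + \<beta> c\<^sup>2 G a (\<beta> + 1)\<close> with \<open>a = c (1 - \<beta>)\<close>, which lies in this cone
  if \<open>0 \<le> \<beta> \<le> 1\<close>. If \<open>\<beta> > 1\<close>, it is positive and tends to 0 at 0, so it is not decreasing.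
\<close>

text \<open>Each differentiation stays in \<open>K\<close> and contributes one minus sign. Agreement
  of \<open>g\<close> with a member of \<open>K\<close> is asked for on the half-line only, since
  that is where the formula for the derivative of \<open>Phi\<close> holds.\<close>

lemma deriv_funpow_stable:
  assumes stable: "\<And>h. h \<in> K \<Longrightarrow> \<exists>k\<in>K. \<forall>s>0. (h has_real_derivative - k s) (at s)"
    and "h \<in> K" and eq: "\<And>s. s > 0 \<Longrightarrow> g s = h s"
  shows "\<exists>k\<in>K. \<forall>s>0. (deriv ^^ n) g s = (-1) ^ n * k s"
proof (induction n)
  case 0
  show ?case using \<open>h \<in> K\<close> eq by auto
next
  case (Suc n)
  then obtain k where k: "k \<in> K" "\<And>s. s > 0 \<Longrightarrow> (deriv ^^ n) g s = (-1) ^ n * k s" by blast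
  obtain l where l: "l \<in> K" "\<And>s. s > 0 \<Longrightarrow> (k has_real_derivative - l s) (at s)"
    using stable[OF k(1)] by blast
  have "(deriv ^^ Suc n) g s = (-1) ^ Suc n * l s" if "s > 0" for s
  proof -
    have "((\<lambda>s. (-1) ^ n * k s) has_real_derivative (-1) ^ n * - l s) (at s)"
      by (rule DERIV_cmult) (rule l(2)[OF that])
    then have "((deriv ^^ n) g has_real_derivative (-1) ^ n * - l s) (at s)"
      \<comment> \<open>The induction hypothesis holds on an open set around \<open>s\<close>, and a
        derivative at \<open>s\<close> depends on nothing else.\<close>
      by (rule has_field_derivative_transform_within_open[of _ _ _ "{0<..}"])
        (use that k(2) in auto)
    then show ?thesis by (simp add: DERIV_imp_deriv)
  qed
  with l(1) show ?case by blast
qed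

text \<open>The two signs \<open>(-1) ^ n\<close> cancel, which leaves a member of \<open>K\<close>:
  it is nonnegative, and stability provides its next derivative.\<close>

lemma CM_stable:
  assumes stable: "\<And>h. h \<in> K \<Longrightarrow> \<exists>k\<in>K. \<forall>s>0. (h has_real_derivative - k s) (at s)"
    and nonneg: "\<And>h s. h \<in> K \<Longrightarrow> s > 0 \<Longrightarrow> h s \<ge> 0"
    and "h \<in> K" and "\<And>s. s > 0 \<Longrightarrow> g s = h s"
  shows "g \<in> CM"
proof -
  have "(deriv ^^ n) g differentiable (at s) \<and> (-1) ^ n * (deriv ^^ n) g s \<ge> 0" if "s > 0" for n s
  proof -
    obtain k where k: "k \<in> K" "\<And>s. s > 0 \<Longrightarrow> (deriv ^^ n) g s = (-1) ^ n * k s"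
      using deriv_funpow_stable[OF assms(1,3,4)] by blast
    obtain l where l: "\<And>s. s > 0 \<Longrightarrow> (k has_real_derivative - l s) (at s)"
      using stable[OF k(1)] by blast
    have "((\<lambda>s. (-1) ^ n * k s) has_real_derivative (-1) ^ n * - l s) (at s)"
      by (rule DERIV_cmult) (rule l[OF that])
    then have "((deriv ^^ n) g has_real_derivative (-1) ^ n * - l s) (at s)"
      by (rule has_field_derivative_transform_within_open[of _ _ _ "{0<..}"])
        (use that k(2) in auto)
    moreover have "(-1) ^ n * (deriv ^^ n) g s = k s"
      using k(2)[OF that] by (simp flip: mult.assoc power_add)
    ultimately show ?thesis
      using nonneg[OF k(1) that] real_differentiable_def by auto
  qed
  then show ?thesis by (simp add: CM_def smooth_pos_def)
qed

lemma BF_I: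
  assumes deriv: "\<And>s. s > 0 \<Longrightarrow> (f has_real_derivative f' s) (at s)"
    and nonneg: "\<And>s. s > 0 \<Longrightarrow> f s \<ge> 0"
    and CM: "deriv f \<in> CM"
  shows "f \<in> BF"
proof -
  have "(deriv ^^ n) f differentiable (at s)" if "s > 0" for n s
  proof (cases n)
    case 0
    with deriv[OF that] show ?thesis using real_differentiable_def by auto
  next
    case (Suc m)
    \<comment> \<open>\<open>funpow_swap1\<close> moves one \<open>deriv\<close> inside, so order
      \<open>Suc m\<close> for \<open>f\<close> becomes order \<open>m\<close> for
      \<open>deriv f\<close>.\<close>
    with CM that show ?thesis
      by (auto simp: CM_def smooth_pos_def funpow_swap1)
  qed
  with nonneg CM show ?thesis by (simp add: BF_def smooth_pos_def)
qed

lemma CM_antimono: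
  assumes "g \<in> CM" and "0 < x" and "x \<le> y"
  shows "g y \<le> g x"
proof (rule DERIV_nonpos_imp_nonincreasing[OF \<open>x \<le> y\<close>])
  fix s assume "x \<le> s" "s \<le> y"
  with \<open>0 < x\<close> have "s > 0" by simp
  have "(deriv ^^ 0) g differentiable (at s)" "(-1) ^ 1 * (deriv ^^ 1) g s \<ge> 0"
    using \<open>g \<in> CM\<close> \<open>s > 0\<close> unfolding CM_def smooth_pos_def by blast+
  then show "\<exists>d. (g has_real_derivative d) (at s) \<and> d \<le> 0"
    using DERIV_deriv_iff_real_differentiable by (auto intro!: exI[of _ "deriv g s"])
qed

text \<open>The exponents carry a minus sign so that, for \<open>c > 0\<close>, nonnegative
  \<open>a\<close> and \<open>p\<close> make both factors nonincreasing on the half-line.\<close>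

definition G :: "real \<Rightarrow> real \<Rightarrow> real \<Rightarrow> real \<Rightarrow> real" where
  "G c a p s = s powr (- a) * (s powr c + c) powr (- p)"

lemma G_pos:
  assumes "0 < c" and "s > 0"
  shows "G c a p s > 0"
proof -
  have "s powr c + c > 0" using assms by (simp add: add_nonneg_pos)
  then show ?thesis using assms by (simp add: G_def)
qed

text \<open>The surplus factor \<open>s powr c\<close> is written as
  \<open>(s powr c + c) - c\<close>. This brings both terms in the derivative of \<open>Phi\<close>
  to the same first exponent.\<close>

lemma G_shift:
  assumes "0 < c" and "s > 0"
  shows "G c (a - c) (p + 1) s = G c a p s - c * G c a (p + 1) s"
proof -
  define u where "u = s powr c + c"
  have u: "u > 0" using assms by (simp add: u_def add_nonneg_pos)
  have 1: "u powr (- p) = u * u powr (- (p + 1))"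
    using u powr_add[of u 1 "- (p + 1)"] by simp
  have 2: "s powr (- (a - c)) = s powr (- a) * s powr c"
    by (simp flip: powr_add)
  show ?thesis
    unfolding G_def u_def[symmetric] 1 2 by (simp add: u_def algebra_simps)
qed

lemma G_deriv:
  assumes "0 < c" and "s > 0"
  shows "(G c a p has_real_derivative - (a * G c (a + 1) p s + p * c * G c (a + 1 - c) (p + 1) s)) (at s)"
proof -
  have u: "s powr c + c > 0" using assms by (simp add: add_nonneg_pos)
  have 1: "s powr (- (a + 1 - c)) = s powr (- a) * s powr (c - 1)"
    by (simp flip: powr_add add: algebra_simps)
  have 2: "- (a + 1) = - a - 1" "- (p + 1) = - p - 1" by simp_all
  have "((\<lambda>s. s powr c + c) has_real_derivative c * s powr (c - 1)) (at s)"
    using DERIV_add[OF has_real_derivative_powr[OF \<open>s > 0\<close>, of c] DERIV_const[of c]] by simp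
  then have "((\<lambda>s. (s powr c + c) powr (- p)) has_real_derivative
      - p * (s powr c + c) powr (- p - 1) * (c * s powr (c - 1))) (at s)"
    by (rule DERIV_chain2[where g = "\<lambda>s. s powr c + c", OF has_real_derivative_powr[OF u]])
  from DERIV_mult[OF has_real_derivative_powr[OF \<open>s > 0\<close>, of "- a"] this]
  show ?thesis
    unfolding G_def[abs_def] 1 2 by (simp add: algebra_simps)
qed

inductive_set cone :: "real \<Rightarrow> (real \<Rightarrow> real) set" for c where
  gen: "a \<ge> 0 \<Longrightarrow> p \<ge> 0 \<Longrightarrow> G c a p \<in> cone c"
| add: "g \<in> cone c \<Longrightarrow> h \<in> cone c \<Longrightarrow> (\<lambda>s. g s + h s) \<in> cone c"
| scale: "r \<ge> 0 \<Longrightarrow> g \<in> cone c \<Longrightarrow> (\<lambda>s. r * g s) \<in> cone c"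

lemma cone_nonneg: "h \<in> cone c \<Longrightarrow> 0 < c \<Longrightarrow> s > 0 \<Longrightarrow> h s \<ge> 0"
  by (induction rule: cone.induct) (auto intro: less_imp_le[OF G_pos])

lemma cone_stable:
  assumes "h \<in> cone c" and "0 < c" and "c < 1"
  shows "\<exists>k\<in>cone c. \<forall>s>0. (h has_real_derivative - k s) (at s)"
  using assms(1)
proof induction
  case (gen a p)
  \<comment> \<open>Here \<open>c < 1\<close> keeps the exponent \<open>a + 1 - c\<close>
    nonnegative; the coefficients \<open>a\<close> and \<open>p * c\<close> are nonnegative as
    well.\<close>
  then have "(\<lambda>s. a * G c (a + 1) p s + p * c * G c (a + 1 - c) (p + 1) s) \<in> cone c"
    using assms by (intro cone.intros) auto
  then show ?case
    using G_deriv[OF \<open>0 < c\<close>] by (intro bexI[rotated]) auto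
next
  case (add g h)
  then obtain k l where kl: "k \<in> cone c" "l \<in> cone c"
    "\<forall>s>0. (g has_real_derivative - k s) (at s)" "\<forall>s>0. (h has_real_derivative - l s) (at s)"
    by blast
  then have "\<forall>s>0. ((\<lambda>s. g s + h s) has_real_derivative - (k s + l s)) (at s)"
    by (auto intro!: derivative_eq_intros)
  with cone.add[OF kl(1,2)] show ?case
    by (intro bexI[of _ "\<lambda>s. k s + l s"])
next
  case (scale r g)
  then obtain k where k: "k \<in> cone c" "\<forall>s>0. (g has_real_derivative - k s) (at s)"
    by blast
  then have "\<forall>s>0. ((\<lambda>s. r * g s) has_real_derivative - (r * k s)) (at s)"
    by (auto intro!: derivative_eq_intros)
  with cone.scale[OF scale(1) k(1)] show ?case
    by (intro bexI[of _ "\<lambda>s. r * k s"])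
qed

text \<open>With \<open>c = 1 - \<alpha>\<close>, the base of the denominator factors as
  \<open>s powr (- c) * (s powr c + c)\<close>, so its power moves
  \<open>s powr (c * \<beta>)\<close> into the numerator.\<close>

lemma Phi_eq_G:
  assumes "\<alpha> < 1" and "s > 0"
  shows "Phi \<alpha> \<beta> s = G (1 - \<alpha>) (- \<alpha> - (1 - \<alpha>) * \<beta>) \<beta> s"
proof -
  define c where "c = 1 - \<alpha>"
  have c: "c > 0" "\<alpha> = 1 - c" using assms by (simp_all add: c_def)
  define u where "u = s powr c + c"
  have u: "u > 0" using c by (simp add: u_def add_nonneg_pos)
  have "1 + c * s powr (- c) = u * s powr (- c)"
    using \<open>s > 0\<close> by (simp add: u_def powr_minus field_simps)
  then have "(1 + c * s powr (- c)) powr \<beta> = u powr \<beta> * s powr (- (c * \<beta>))"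
    using u by (simp add: powr_mult powr_powr)
  then have "s powr \<alpha> / (1 + c * s powr (- c)) powr \<beta>
      = s powr \<alpha> * s powr (c * \<beta>) * u powr (- \<beta>)"
    by (simp add: powr_minus_divide)
  also have "s powr \<alpha> * s powr (c * \<beta>) = s powr (- (- \<alpha> - c * \<beta>))"
    by (simp flip: powr_add add: add.commute)
  finally show ?thesis
    by (simp add: Phi_def G_def u_def c(2))
qed

text \<open>\<open>G_deriv\<close> alone gives the coefficient
  \<open>- b = \<alpha> + c * \<beta>\<close> and a negative second term. Shifting that term cancels
  \<open>c * \<beta>\<close>, so that for \<open>\<alpha>, \<beta> \<ge> 0\<close> both coefficients
  are nonnegative.\<close>

lemma Phi_deriv:
  assumes "\<alpha> < 1" and "s > 0" and c: "c = 1 - \<alpha>"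
  shows "(Phi \<alpha> \<beta> has_real_derivative
    \<alpha> * G c (c * (1 - \<beta>)) \<beta> s + \<beta> * c\<^sup>2 * G c (c * (1 - \<beta>)) (\<beta> + 1) s) (at s)"
proof -
  have "c > 0" using assms by simp
  define b where "b = - \<alpha> - c * \<beta>"
  have b: "b + 1 = c * (1 - \<beta>)" by (simp add: b_def c algebra_simps)
  have "- (b * G c (b + 1) \<beta> s + \<beta> * c * G c (b + 1 - c) (\<beta> + 1) s)
      = \<alpha> * G c (b + 1) \<beta> s + \<beta> * c\<^sup>2 * G c (b + 1) (\<beta> + 1) s"
    unfolding G_shift[OF \<open>c > 0\<close> \<open>s > 0\<close>] by (simp add: b_def power2_eq_square algebra_simps)
  with G_deriv[OF \<open>c > 0\<close> \<open>s > 0\<close>, of b \<beta>]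
  have "(G c b \<beta> has_real_derivative
      \<alpha> * G c (b + 1) \<beta> s + \<beta> * c\<^sup>2 * G c (b + 1) (\<beta> + 1) s) (at s)" by simp
  then show ?thesis
    unfolding b
    by (rule has_field_derivative_transform_within_open[of _ _ _ "{0<..}"])
      (use assms in \<open>auto simp: Phi_eq_G b_def\<close>)
qed

text \<open>The first factor is a positive power of \<open>s\<close>, while the second tends to the
  finite value \<open>c powr (- p)\<close>.\<close>

lemma G_tendsto_0:
  assumes "0 < c" and "a < 0"
  shows "(G c a p \<longlongrightarrow> 0) (at_right 0)"
proof -
  have powr: "((\<lambda>s::real. s powr d) \<longlongrightarrow> 0) (at_right 0)" if "d > 0" for d
    using that by (intro tendsto_eq_intros) (auto intro: eventually_mono[OF eventually_at_right_less])
  have "(G c a p \<longlongrightarrow> 0 * (0 + c) powr (- p)) (at_right 0)"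
    unfolding G_def[abs_def] using assms by (intro tendsto_intros powr) auto
  then show ?thesis by simp
qed

theorem corollary3p8:
  fixes \<alpha> \<beta> :: real
  assumes "0 < \<alpha>" and "\<alpha> < 1" and "\<beta> \<ge> 0"
  shows "Phi \<alpha> \<beta> \<in> BF \<longleftrightarrow> 0 \<le> \<beta> \<and> \<beta> \<le> 1"
proof
  define c where "c = 1 - \<alpha>"
  have c: "0 < c" "c < 1" using assms by (simp_all add: c_def)
  define D where
    "D = (\<lambda>s. \<alpha> * G c (c * (1 - \<beta>)) \<beta> s + \<beta> * c\<^sup>2 * G c (c * (1 - \<beta>)) (\<beta> + 1) s)"
  have deriv: "(Phi \<alpha> \<beta> has_real_derivative D s) (at s)" if "s > 0" for s
    unfolding D_def using Phi_deriv[OF \<open>\<alpha> < 1\<close> that c_def] .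
  have D: "deriv (Phi \<alpha> \<beta>) s = D s" if "s > 0" for s
    using deriv[OF that] by (rule DERIV_imp_deriv)
  {
    assume BF: "Phi \<alpha> \<beta> \<in> BF"
    have "\<not> \<beta> > 1"
    proof
      assume "\<beta> > 1"
      then have "c * (1 - \<beta>) < 0" using c by (simp add: mult_less_0_iff)
      note lim = G_tendsto_0[OF c(1) this]
      have "(D \<longlongrightarrow> \<alpha> * 0 + \<beta> * c\<^sup>2 * 0) (at_right 0)"
        unfolding D_def by (intro tendsto_intros lim)
      then have "(D \<longlongrightarrow> 0) (at_right 0)" by simp
      \<comment> \<open>A completely monotone derivative is nonincreasing, so its value at the
        arbitrarily chosen point 1 bounds it from below near 0.\<close>
      moreover have "\<forall>\<^sub>F s in at_right 0. D 1 \<le> D s"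
        unfolding eventually_at_right_field
      proof (intro exI[of _ 1] conjI allI impI)
        fix s :: real assume "0 < s" "s < 1"
        then show "D 1 \<le> D s"
          using CM_antimono[of "deriv (Phi \<alpha> \<beta>)" s 1] BF D by (simp add: BF_def)
      qed simp
      ultimately have "D 1 \<le> 0"
        by (rule tendsto_lowerbound) simp
      \<comment> \<open>Strictness comes from the first term, through
        \<open>\<alpha> > 0\<close>.\<close>
      moreover have "D 1 > 0"
        unfolding D_def using G_pos[OF c(1), of 1] assms
        by (intro add_pos_nonneg mult_pos_pos mult_nonneg_nonneg) (auto intro: less_imp_le)
      ultimately show False by simp
    qed
    with \<open>\<beta> \<ge> 0\<close> show "0 \<le> \<beta> \<and> \<beta> \<le> 1" by simp
  next
    assume "0 \<le> \<beta> \<and> \<beta> \<le> 1"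
    \<comment> \<open>The bound \<open>\<beta> \<le> 1\<close> enters here: it makes the first
      exponent \<open>c * (1 - \<beta>)\<close> nonnegative.\<close>
    then have "D \<in> cone c"
      unfolding D_def using c assms by (intro cone.intros) auto
    then have "deriv (Phi \<alpha> \<beta>) \<in> CM"
      using CM_stable[of "cone c"] cone_stable cone_nonneg c D by blast
    then show "Phi \<alpha> \<beta> \<in> BF"
      by (rule BF_I[rotated 2]) (use deriv in \<open>auto simp: Phi_def\<close>)
  }
qed

end
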